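(* For real $t\ge0$ let $$\begin{aligned}S_t(x,y,z)={}&t^4(x^6+y^6+z^6)+(1-2t^6)(x^4y^2+y^4z^2+z^4x^2)\\&+(t^8-2t^2)(x^2y^4+y^2z^4+z^2x^4)-3(1-2t^2+t^4-2t^6+t^8)x^2y^2z^2.\end{aligned}$$ Then $S_t\in\Delta_{3,6}$, $S_t$ has exactly ten zeros if $t>0$, $S_0=S$ and $S_1=R$.
   Context: $S(x,y,z)=x^4y^2+y^4z^2+z^4x^2-3x^2y^2z^2$ and $R(x,y,z)=x^6+y^6+z^6-x^4y^2-x^2y^4-x^4z^2-y^4z^2-x^2z^4-y^2z^4+3x^2y^2z^2$. $\Delta_{3,6}$ is the set of real ternary sextic forms that are psd (nonnegative on $\mathbb R^3$) but not sos (not a finite sum of squares of real forms). The zeros of a form are its nonzero real zeros, counted as lines through the origin (real projective points). *)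

theory Defs
  imports "HOL-Analysis.Analysis" "HOL-Library.Poly_Mapping"
begin

text \<open>
  Real polynomials in variables indexed by a finite type \<open>'n\<close>: finitely supported maps from
  exponent vectors to coefficients, with the convolution ring structure of
  \<^theory>\<open>HOL-Library.Poly_Mapping\<close>.
\<close>

type_synonym 'n rpoly = "('n \<Rightarrow>\<^sub>0 nat) \<Rightarrow>\<^sub>0 real"

definition Var :: "'n \<Rightarrow> 'n rpoly" where
  "Var i = Poly_Mapping.single (Poly_Mapping.single i 1) 1"

definition Const :: "real \<Rightarrow> 'n rpoly" where
  "Const c = Poly_Mapping.single 0 c"

definition eval_at :: "'n::finite rpoly \<Rightarrow> real ^ 'n \<Rightarrow> real" where
  "eval_at p v =
     (\<Sum>m\<in>Poly_Mapping.keys p. Poly_Mapping.lookup p m * (\<Prod>i\<in>UNIV. v $ i ^ Poly_Mapping.lookup m i))"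

text \<open>As usual, the zero polynomial counts as a form of every degree.\<close>

definition is_form :: "nat \<Rightarrow> 'n::finite rpoly \<Rightarrow> bool" where
  "is_form d p \<longleftrightarrow> (\<forall>m\<in>Poly_Mapping.keys p. (\<Sum>i\<in>UNIV. Poly_Mapping.lookup m i) = d)"

definition psd :: "'n::finite rpoly \<Rightarrow> bool" where
  "psd p \<longleftrightarrow> (\<forall>v. eval_at p v \<ge> 0)"

definition sos :: "'n::finite rpoly \<Rightarrow> bool" where
  "sos p \<longleftrightarrow> (\<exists>(k::nat) q. (\<forall>j<k. \<exists>d. is_form d (q j)) \<and> p = (\<Sum>j<k. (q j)\<^sup>2))"

definition Delta_3_6 :: "3 rpoly set" where
  "Delta_3_6 = {p. is_form 6 p \<and> psd p \<and> \<not> sos p}"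

text \<open>Zeros are real projective points, represented as lines through the origin.\<close>

definition proj_zeros :: "'n::finite rpoly \<Rightarrow> (real ^ 'n) set set" where
  "proj_zeros p = {span {v} | v. v \<noteq> 0 \<and> eval_at p v = 0}"

text \<open>In the index type \<open>3\<close> the three elements are \<open>1\<close>, \<open>2\<close> and \<open>3 = 0\<close>.\<close>

abbreviation x :: "3 rpoly" where "x \<equiv> Var 1"
abbreviation y :: "3 rpoly" where "y \<equiv> Var 2"
abbreviation z :: "3 rpoly" where "z \<equiv> Var 3"

definition form_S :: "3 rpoly" where
  "form_S = x^4 * y^2 + y^4 * z^2 + z^4 * x^2 - 3 * x^2 * y^2 * z^2"

definition form_R :: "3 rpoly" where
  "form_R = x^6 + y^6 + z^6 - x^4 * y^2 - x^2 * y^4 - x^4 * z^2 - y^4 * z^2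
            - x^2 * z^4 - y^2 * z^4 + 3 * x^2 * y^2 * z^2"

definition form_St :: "real \<Rightarrow> 3 rpoly" where
  "form_St t =
     Const (t^4) * (x^6 + y^6 + z^6)
   + Const (1 - 2 * t^6) * (x^4 * y^2 + y^4 * z^2 + z^4 * x^2)
   + Const (t^8 - 2 * t^2) * (x^2 * y^4 + y^2 * z^4 + z^2 * x^4)
   - Const (3 * (1 - 2 * t^2 + t^4 - 2 * t^6 + t^8)) * x^2 * y^2 * z^2"

text \<open>The names \<open>x\<close>, \<open>y\<close>, \<open>z\<close> are released for ordinary use.\<close>

hide_const (open) x y z

end

theory Submission
  imports Defs
begin

text \<open>
  Put \<open>s = t\<^sup>2\<close> and let \<open>F\<close> be the ternary cubic with \<open>S\<^sub>t(x,y,z) = F(x\<^sup>2,y\<^sup>2,z\<^sup>2)\<close>. Then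
  \<open>F(X, X + a, X + b) = (s\<^sup>2 - s + 1)\<^sup>2 X (a\<^sup>2 - a b + b\<^sup>2) + (a - s b)\<^sup>2 (s\<^sup>2 a + b)\<close>; as \<open>F\<close> is
  cyclic one may take \<open>X\<close> to be the smallest variable, which gives positivity and the zeros.

  If \<open>S\<^sub>t = \<Sum> q\<^sub>j\<^sup>2\<close>, then \<open>q\<^sub>j\<^sup>2 \<le> S\<^sub>t\<close> pointwise and only cubic \<open>q\<^sub>j\<close> contribute. Such a cubic is
  \<open>x f + y g + z h + d x y z\<close> with \<open>f\<close>, \<open>g\<close>, \<open>h\<close> linear in the squares, and the zeros of \<open>S\<^sub>t\<close>
  force \<open>d = 0\<close> and make \<open>f\<close> vanish at \<open>(1,1,1)\<close>, \<open>(s,1,0)\<close>, \<open>(1,0,s)\<close>. Their determinant is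
  \<open>-(s\<^sup>2 - s + 1) \<noteq> 0\<close>, so \<open>f = 0\<close>, and likewise \<open>g = h = 0\<close>.
\<close>

section \<open>Evaluation and homogeneity of polynomials\<close>

definition monomial_at :: "('n::finite \<Rightarrow>\<^sub>0 nat) \<Rightarrow> real ^ 'n \<Rightarrow> real" where
  "monomial_at m v = (\<Prod>i\<in>UNIV. v $ i ^ Poly_Mapping.lookup m i)"

lemma monomial_at_add: "monomial_at (m + n) v = monomial_at m v * monomial_at n v"
  by (simp add: monomial_at_def lookup_add power_add prod.distrib)

lemma monomial_at_zero [simp]: "monomial_at 0 v = 1"
  by (simp add: monomial_at_def)

text \<open>Cancellation can shrink the keys of a sum, so \<open>p\<close>, \<open>q\<close> and
  \<open>p + q\<close> are compared over one common index set.\<close>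

lemma eval_at_superset:
  assumes "finite A" "Poly_Mapping.keys p \<subseteq> A"
  shows "eval_at p v = (\<Sum>m\<in>A. Poly_Mapping.lookup p m * monomial_at m v)"
  unfolding eval_at_def monomial_at_def
  using assms by (intro sum.mono_neutral_left) (auto simp: in_keys_iff)

lemma eval_at_zero [simp]: "eval_at 0 v = 0"
  by (simp add: eval_at_def)

lemma eval_at_single: "eval_at (Poly_Mapping.single m c) v = c * monomial_at m v"
  using eval_at_superset[of "{m}" "Poly_Mapping.single m c" v] by simp

lemma eval_at_add: "eval_at (p + q) v = eval_at p v + eval_at q v"
proof -
  let ?A = "Poly_Mapping.keys p \<union> Poly_Mapping.keys q"
  have "Poly_Mapping.keys (p + q) \<subseteq> ?A" by (rule keys_add)
  then have "eval_at (p + q) v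
      = (\<Sum>m\<in>?A. Poly_Mapping.lookup (p + q) m * monomial_at m v)"
    by (intro eval_at_superset) auto
  also have "\<dots> = (\<Sum>m\<in>?A. Poly_Mapping.lookup p m * monomial_at m v)
      + (\<Sum>m\<in>?A. Poly_Mapping.lookup q m * monomial_at m v)"
    by (simp add: lookup_add distrib_right sum.distrib)
  also have "\<dots> = eval_at p v + eval_at q v"
    using eval_at_superset[of ?A p v] eval_at_superset[of ?A q v] by simp
  finally show ?thesis .
qed

lemma eval_at_minus: "eval_at (p - q) v = eval_at p v - eval_at q v"
  using eval_at_add[of "p - q" q v] by simp

lemma eval_at_sum: "eval_at (\<Sum>j\<in>A. f j) v = (\<Sum>j\<in>A. eval_at (f j) v)"
  by (induction A rule: infinite_finite_induct) (simp_all add: eval_at_add)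

lemma poly_mapping_eq_sum_single:
  "p = (\<Sum>m\<in>Poly_Mapping.keys p. Poly_Mapping.single m (Poly_Mapping.lookup p m))"
  by (rule poly_mapping_eqI)
    (auto simp: lookup_sum lookup_single when_def in_keys_iff)

lemma eval_at_mult: "eval_at (p * q) v = eval_at p v * eval_at q v"
proof -
  let ?s = "\<lambda>p m. Poly_Mapping.single m (Poly_Mapping.lookup p m)"
  have "p * q = (\<Sum>m\<in>Poly_Mapping.keys p. ?s p m) * (\<Sum>n\<in>Poly_Mapping.keys q. ?s q n)"
    using poly_mapping_eq_sum_single[of p] poly_mapping_eq_sum_single[of q] by simp
  also have "\<dots> = (\<Sum>m\<in>Poly_Mapping.keys p. \<Sum>n\<in>Poly_Mapping.keys q. ?s p m * ?s q n)"
    by (rule sum_product)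
  finally have "eval_at (p * q) v = (\<Sum>m\<in>Poly_Mapping.keys p. \<Sum>n\<in>Poly_Mapping.keys q.
      (Poly_Mapping.lookup p m * monomial_at m v) * (Poly_Mapping.lookup q n * monomial_at n v))"
    by (simp only: eval_at_sum eval_at_single mult_single monomial_at_add mult_ac)
  then show ?thesis
    by (simp only: sum_product eval_at_superset[OF finite_keys order_refl])
qed

lemma eval_at_one [simp]: "eval_at 1 v = 1"
  using eval_at_single[of 0 1 v] by simp

lemma eval_at_power: "eval_at (p ^ n) v = eval_at p v ^ n"
  by (induction n) (simp_all add: eval_at_mult)

lemma eval_at_Const: "eval_at (Const c) v = c"
  by (simp add: Const_def eval_at_single)

lemma eval_at_Var: "eval_at (Var i) v = v $ i"
proof -
  have "monomial_at (Poly_Mapping.single i 1) v = (\<Prod>j\<in>UNIV. if j = i then v $ j else 1)"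
    unfolding monomial_at_def by (rule prod.cong) (auto simp: lookup_single when_def)
  then show ?thesis by (simp add: Var_def eval_at_single)
qed

section \<open>Homogeneity and degree\<close>

lemma is_form_add: "is_form d p \<Longrightarrow> is_form d q \<Longrightarrow> is_form d (p + q)"
  using keys_add[of p q] by (auto simp: is_form_def)

lemma is_form_minus: "is_form d p \<Longrightarrow> is_form d q \<Longrightarrow> is_form d (p - q)"
  using is_form_add[of d p "- q"] by (simp add: is_form_def in_keys_iff)

lemma is_form_mult: "is_form d p \<Longrightarrow> is_form e q \<Longrightarrow> is_form (d + e) (p * q)"
  using keys_mult[of p q] by (fastforce simp: is_form_def lookup_add sum.distrib)

lemma is_form_power: "is_form d p \<Longrightarrow> is_form (n * d) (p ^ n)"
proof (induction n)
  case 0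
  show ?case by (simp add: is_form_def)
next
  case (Suc n)
  then show ?case using is_form_mult[of d p "n * d" "p ^ n"] by simp
qed

lemma is_form_Const: "is_form 0 (Const c)"
  by (simp add: is_form_def Const_def)

lemma is_form_Var: "is_form 1 (Var i)"
proof -
  have "(\<Sum>j\<in>UNIV. Poly_Mapping.lookup (Poly_Mapping.single i (1::nat)) j)
      = (\<Sum>j\<in>UNIV. if j = i then 1 else 0)"
    by (rule sum.cong) (auto simp: lookup_single when_def)
  then show ?thesis by (simp add: is_form_def Var_def)
qed

lemma is_form_eval_scale:
  assumes "is_form d p"
  shows "eval_at p (l *\<^sub>R v) = l ^ d * eval_at p v"
proof -
  have "monomial_at m (l *\<^sub>R v) = l ^ d * monomial_at m v" if "m \<in> Poly_Mapping.keys p" for m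
    using assms that
    by (simp add: monomial_at_def power_mult_distrib prod.distrib is_form_def flip: power_sum)
  then show ?thesis
    by (simp add: eval_at_superset[OF finite_keys order_refl] sum_distrib_left mult_ac)
qed

text \<open>\<open>sos\<close> lets every summand have its own degree. Scaling \<open>w\<close> by
  \<open>l\<close> compares \<open>l ^ (2 * d)\<close> with \<open>l ^ (2 * e)\<close> up to
  constants: large \<open>l\<close> excludes \<open>d > e\<close>, small \<open>l\<close> excludes
  \<open>d < e\<close>.\<close>

lemma square_le_form_imp_degree:
  assumes q: "is_form d q" and p: "is_form (2 * e) p"
    and le: "\<And>v. (eval_at q v)\<^sup>2 \<le> eval_at p v" and nz: "eval_at q w \<noteq> 0"
  shows "d = e"
proof (rule ccontr)
  assume "d \<noteq> e"
  define A where "A = (eval_at q w)\<^sup>2"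
  define B where "B = eval_at p w"
  have A: "A > 0" using nz by (simp add: A_def)
  have "A \<le> B" using le by (simp add: A_def B_def)
  have *: "l ^ (2 * d) * A \<le> l ^ (2 * e) * B" for l
    using le[of "l *\<^sub>R w"]
    by (simp add: is_form_eval_scale[OF q] is_form_eval_scale[OF p] A_def B_def
        power_mult_distrib mult.commute flip: power_mult)
  \<comment> \<open>Chosen so that already one factor \<open>c\<close> lifts \<open>A\<close> above
    \<open>B\<close>; the scalings by \<open>c\<close> and by its inverse then refute the two
    cases.\<close>
  define c where "c = B / A + 1"
  have c: "c > 1" "c * A > B" using A \<open>A \<le> B\<close> by (auto simp: c_def field_simps)
  have step: "c \<le> c ^ (2 * n)" if "n > 0" for n
    using c(1) that by (intro self_le_power) auto
  show False
  proof (cases "e < d")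
    case True
    then have "c ^ (2 * d) = c ^ (2 * e) * c ^ (2 * (d - e))"
      by (simp add: diff_mult_distrib2 flip: power_add)
    with *[of c] c(1) have "c ^ (2 * (d - e)) * A \<le> B"
      by (simp add: mult.assoc)
    moreover have "c * A \<le> c ^ (2 * (d - e)) * A"
      using step[of "d - e"] True A by (intro mult_right_mono) auto
    ultimately show False using c(2) by linarith
  next
    case False
    then have "c ^ (2 * e) = c ^ (2 * d) * c ^ (2 * (e - d))"
      by (simp add: diff_mult_distrib2 flip: power_add)
    with *[of "inverse c"] c(1) have "c ^ (2 * (e - d)) * A \<le> B"
      by (simp add: field_simps)
    moreover have "c * A \<le> c ^ (2 * (e - d)) * A"
      using step[of "e - d"] False \<open>d \<noteq> e\<close> A by (intro mult_right_mono) auto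
    ultimately show False using c(2) by linarith
  qed
qed

lemma monomial_at_3:
  fixes v :: "real ^ 3"
  shows "monomial_at m v = v $ 1 ^ Poly_Mapping.lookup m 1 * v $ 2 ^ Poly_Mapping.lookup m 2
    * v $ 3 ^ Poly_Mapping.lookup m 3"
  unfolding monomial_at_def UNIV_3 by (simp add: mult.assoc)

lemma eval_at_ternary_form:
  fixes p :: "3 rpoly"
  assumes "is_form d p"
  obtains c where "\<And>v. eval_at p v
    = (\<Sum>a\<le>d. \<Sum>b\<le>d - a. c a b * v $ 1 ^ a * v $ 2 ^ b * v $ 3 ^ (d - a - b))"
proof -
  \<comment> \<open>The degree fixes the third exponent, so pairs \<open>(a, b)\<close> index the
    monomials; on \<open>I\<close> the subtraction is never truncated.\<close>
  define M where "M = (\<lambda>(a, b). Poly_Mapping.single 1 a + Poly_Mapping.single 2 b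
      + Poly_Mapping.single 3 (d - a - b) :: 3 \<Rightarrow>\<^sub>0 nat)"
  define I where "I = (SIGMA a:{..d}. {..d - a})"
  have look: "Poly_Mapping.lookup (M (a, b)) 1 = a" "Poly_Mapping.lookup (M (a, b)) 2 = b"
    "Poly_Mapping.lookup (M (a, b)) 3 = d - a - b" for a b
    by (simp_all add: M_def lookup_add lookup_single when_def)
  have inj: "inj_on M I"
    by (intro inj_onI) (metis look(1,2) prod.exhaust)
  have fin: "finite (M ` I)" by (simp add: I_def)
  have keys: "Poly_Mapping.keys p \<subseteq> M ` I"
  proof
    fix m assume "m \<in> Poly_Mapping.keys p"
    then have sum: "Poly_Mapping.lookup m 1 + Poly_Mapping.lookup m 2
        + Poly_Mapping.lookup m 3 = d"
      using assms by (auto simp: is_form_def sum_3)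
    have "Poly_Mapping.lookup m i
        = Poly_Mapping.lookup (M (Poly_Mapping.lookup m 1, Poly_Mapping.lookup m 2)) i" for i
      using exhaust_3[of i] look sum by auto
    then have "m = M (Poly_Mapping.lookup m 1, Poly_Mapping.lookup m 2)"
      by (rule poly_mapping_eqI)
    moreover have "(Poly_Mapping.lookup m 1, Poly_Mapping.lookup m 2) \<in> I"
      using sum by (auto simp: I_def)
    ultimately show "m \<in> M ` I" by blast
  qed
  have "eval_at p v = (\<Sum>a\<le>d. \<Sum>b\<le>d - a. Poly_Mapping.lookup p (M (a, b))
      * v $ 1 ^ a * v $ 2 ^ b * v $ 3 ^ (d - a - b))" for v
  proof -
    have "eval_at p v = (\<Sum>m\<in>M ` I. Poly_Mapping.lookup p m * monomial_at m v)"
      by (rule eval_at_superset[OF fin keys])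
    also have "\<dots> = (\<Sum>k\<in>I. Poly_Mapping.lookup p (M k) * monomial_at (M k) v)"
      using inj by (simp add: sum.reindex)
    also have "\<dots> = (\<Sum>(a, b)\<in>I. Poly_Mapping.lookup p (M (a, b))
        * v $ 1 ^ a * v $ 2 ^ b * v $ 3 ^ (d - a - b))"
      by (rule sum.cong) (auto simp: monomial_at_3 look mult.assoc)
    also have "\<dots> = (\<Sum>a\<le>d. \<Sum>b\<le>d - a. Poly_Mapping.lookup p (M (a, b))
        * v $ 1 ^ a * v $ 2 ^ b * v $ 3 ^ (d - a - b))"
      unfolding I_def by (rule sum.Sigma[symmetric]) auto
    finally show ?thesis .
  qed
  then show ?thesis by (rule that)
qed

section \<open>The cyclic cubic\<close>

definition cyc_cubic :: "real \<Rightarrow> real \<Rightarrow> real \<Rightarrow> real \<Rightarrow> real" where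
  "cyc_cubic s X Y Z = s^2 * (X^3 + Y^3 + Z^3)
    + (1 - 2 * s^3) * (X^2 * Y + Y^2 * Z + Z^2 * X)
    + (s^4 - 2 * s) * (X * Y^2 + Y * Z^2 + Z * X^2)
    - 3 * (1 - 2 * s + s^2 - 2 * s^3 + s^4) * (X * Y * Z)"

lemma cyc_cubic_rotate: "cyc_cubic s Y Z X = cyc_cubic s X Y Z"
  unfolding cyc_cubic_def by algebra

text \<open>Taylor expansion along the direction (1,1,1). The terms in X^3 and X^2 are absent
  because (1,1,1) is a singular zero of the cubic.\<close>

lemma cyc_cubic_shift:
  "cyc_cubic s X (X + a) (X + b)
    = (s\<^sup>2 - s + 1)\<^sup>2 * X * (a\<^sup>2 - a * b + b\<^sup>2) + (a - s * b)\<^sup>2 * (s\<^sup>2 * a + b)"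
  unfolding cyc_cubic_def by algebra

lemma cyc_cubic_boundary:
  "cyc_cubic s X Y 0 = (X - s * Y)\<^sup>2 * (s\<^sup>2 * X + Y)"
  using cyc_cubic_shift[of s 0 X Y] cyc_cubic_rotate[of s X Y 0] by simp

lemma cyc_cubic_zeros:
  "cyc_cubic s 1 1 1 = 0" "cyc_cubic s s 1 0 = 0" "cyc_cubic s 0 s 1 = 0" "cyc_cubic s 1 0 s = 0"
proof -
  show "cyc_cubic s 1 1 1 = 0" using cyc_cubic_shift[of s 1 0 0] by simp
  show "cyc_cubic s s 1 0 = 0" by (simp add: cyc_cubic_boundary)
  then show "cyc_cubic s 0 s 1 = 0" "cyc_cubic s 1 0 s = 0" by (metis cyc_cubic_rotate)+
qed

lemma quadratic_form_disc: "a\<^sup>2 - a * b + b\<^sup>2 = (a - b / 2)\<^sup>2 + 3 / 4 * (b::real)\<^sup>2"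
  by (simp add: field_simps power2_eq_square)

lemma discr_pos: "s\<^sup>2 - s + 1 > (0::real)"
  using quadratic_form_disc[of s 1] by (simp add: add_nonneg_pos)

text \<open>At most two rotations bring a smallest entry to the front. Only rotations are used,
  since the cubic is not symmetric for general \<open>s\<close>.\<close>

lemma cyclic_wlog_min:
  fixes P :: "'a::linorder \<Rightarrow> 'a \<Rightarrow> 'a \<Rightarrow> bool"
  assumes rot: "\<And>X Y Z. P Y Z X \<Longrightarrow> P X Y Z"
    and min: "\<And>X Y Z. X \<le> Y \<Longrightarrow> X \<le> Z \<Longrightarrow> P X Y Z"
  shows "P X Y Z"
  using min rot by (metis linear order.trans)

lemma cyc_cubic_nonneg:
  assumes "s \<ge> 0" "X \<ge> 0" "Y \<ge> 0" "Z \<ge> 0"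
  shows "cyc_cubic s X Y Z \<ge> 0"
proof -
  \<comment> \<open>The sign conditions belong to the rotated predicate, so that they move along
    with the variables.\<close>
  have "X \<ge> 0 \<longrightarrow> Y \<ge> 0 \<longrightarrow> Z \<ge> 0 \<longrightarrow> cyc_cubic s X Y Z \<ge> 0"
  proof (rule cyclic_wlog_min[of _ X Y Z])
    fix X Y Z :: real
    assume "X \<le> Y" "X \<le> Z"
    then show "X \<ge> 0 \<longrightarrow> Y \<ge> 0 \<longrightarrow> Z \<ge> 0 \<longrightarrow> cyc_cubic s X Y Z \<ge> 0"
      using cyc_cubic_shift[of s X "Y - X" "Z - X"] assms(1)
      by (simp add: quadratic_form_disc)
  qed (metis cyc_cubic_rotate)
  with assms show ?thesis by simp
qed

lemma cyc_cubic_zero_cases: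
  assumes s: "s > 0" and "X \<ge> 0" "Y \<ge> 0" "Z \<ge> 0" and "cyc_cubic s X Y Z = 0"
  shows "X = Y \<and> Y = Z \<or> X = s * Y \<and> Z = 0 \<or> Y = s * Z \<and> X = 0 \<or> Z = s * X \<and> Y = 0"
    (is "?C X Y Z")
proof -
  have "X \<ge> 0 \<longrightarrow> Y \<ge> 0 \<longrightarrow> Z \<ge> 0 \<longrightarrow> cyc_cubic s X Y Z = 0 \<longrightarrow> ?C X Y Z"
  proof (rule cyclic_wlog_min[of _ X Y Z])
    fix X Y Z :: real
    assume le: "X \<le> Y" "X \<le> Z"
    show "X \<ge> 0 \<longrightarrow> Y \<ge> 0 \<longrightarrow> Z \<ge> 0 \<longrightarrow> cyc_cubic s X Y Z = 0 \<longrightarrow> ?C X Y Z"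
    proof (intro impI)
      assume nn: "X \<ge> 0" "Y \<ge> 0" "Z \<ge> 0" and 0: "cyc_cubic s X Y Z = 0"
      define a where "a = Y - X"
      define b where "b = Z - X"
      have ab: "a \<ge> 0" "b \<ge> 0" "Y = X + a" "Z = X + b" using le by (auto simp: a_def b_def)
      have "(s\<^sup>2 - s + 1)\<^sup>2 * X * (a\<^sup>2 - a * b + b\<^sup>2) \<ge> 0"
        using nn by (simp add: quadratic_form_disc)
      moreover have "(a - s * b)\<^sup>2 * (s\<^sup>2 * a + b) \<ge> 0" using ab s by simp
      ultimately have 1: "(s\<^sup>2 - s + 1)\<^sup>2 * X * (a\<^sup>2 - a * b + b\<^sup>2) = 0"
        and 2: "(a - s * b)\<^sup>2 * (s\<^sup>2 * a + b) = 0"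
        using 0 cyc_cubic_shift[of s X a b] ab(3,4) by (simp_all add: add_nonneg_eq_0_iff)
      have "s\<^sup>2 * a + b = 0 \<Longrightarrow> a = 0 \<and> b = 0"
        using ab s by (simp add: add_nonneg_eq_0_iff)
      \<comment> \<open>If the linear factor is the one that vanishes, then
        \<open>a = b = 0\<close>, and the equation holds as well.\<close>
      with 2 have ab2: "a = s * b" by auto
      show "?C X Y Z"
      proof (cases "X = 0")
        case True
        then show ?thesis using ab ab2 by simp
      next
        case False
        with 1 discr_pos[of s] have "(a - b / 2)\<^sup>2 + 3 / 4 * b\<^sup>2 = 0"
          by (simp add: quadratic_form_disc)
        then have "b = 0" "a = 0" by (auto simp: add_nonneg_eq_0_iff)
        then show ?thesis using ab by simp
      qed
    qed
  next
    fix X Y Z :: real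
    assume "Y \<ge> 0 \<longrightarrow> Z \<ge> 0 \<longrightarrow> X \<ge> 0 \<longrightarrow> cyc_cubic s Y Z X = 0 \<longrightarrow> ?C Y Z X"
    then show "X \<ge> 0 \<longrightarrow> Y \<ge> 0 \<longrightarrow> Z \<ge> 0 \<longrightarrow> cyc_cubic s X Y Z = 0 \<longrightarrow> ?C X Y Z"
      by (auto simp: cyc_cubic_rotate)
  qed
  with assms show ?thesis by simp
qed

section \<open>Cubics dominated by the sextic\<close>

text \<open>The bound will come from cancelling \<open>x\<^sup>2\<close>, hence only for nonzero
  \<open>x\<close>; letting \<open>x\<close> tend to 0 recovers the value at 0.\<close>

lemma quadratic_square_le_imp_const_zero:
  fixes a b c :: real
  assumes "\<And>x. x \<noteq> 0 \<Longrightarrow> (a * x\<^sup>2 + b * x + c)\<^sup>2 \<le> x\<^sup>2"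
  shows "c = 0"
proof -
  have "((\<lambda>x. x\<^sup>2 - (a * x\<^sup>2 + b * x + c)\<^sup>2) \<longlongrightarrow> 0\<^sup>2 - (a * 0\<^sup>2 + b * 0 + c)\<^sup>2) (at 0)"
    by (intro tendsto_intros)
  moreover have "\<forall>\<^sub>F x in at 0. 0 \<le> x\<^sup>2 - (a * x\<^sup>2 + b * x + c)\<^sup>2"
    using assms by (auto simp: eventually_at_filter)
  ultimately have "0 \<le> 0\<^sup>2 - (a * 0\<^sup>2 + b * 0 + c)\<^sup>2"
    by (rule tendsto_lowerbound) simp
  then show ?thesis by simp
qed

text \<open>For \<open>t = 0\<close> the zeros \<open>(\<plusminus>t, 1, 0)\<close> coincide, so they say nothing about the part of the cubic
  odd in \<open>x\<close>; there the order of vanishing along \<open>x = 0\<close> takes over.\<close>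

lemma dominated_boundary_cubic:
  fixes t a b c d :: real
  assumes "\<And>x. (a * x^3 + b * x^2 + c * x + d)\<^sup>2 \<le> (x\<^sup>2 - t\<^sup>2)\<^sup>2 * (t^4 * x\<^sup>2 + 1)"
  shows "a * t\<^sup>2 + c = 0" "b * t\<^sup>2 + d = 0"
proof -
  \<comment> \<open>The bound vanishes at \<open>t\<close> and \<open>- t\<close>, so the cubic does
    too; adding and subtracting the two equations separates its even and odd parts.\<close>
  have p: "a * t^3 + b * t^2 + c * t + d = 0" using assms[of t] by simp
  have m: "- (a * t^3) + b * t^2 - c * t + d = 0" using assms[of "- t"] by simp
  show d: "b * t\<^sup>2 + d = 0" using p m by linarith
  show "a * t\<^sup>2 + c = 0"
  proof (cases "t = 0")
    case False
    have "t * (a * t\<^sup>2 + c) = 0" using p m by (simp add: algebra_simps power3_eq_cube power2_eq_square)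
    with False show ?thesis by simp
  next
    case True
    have "(a * x\<^sup>2 + b * x + c)\<^sup>2 \<le> x\<^sup>2" if "x \<noteq> 0" for x
    proof -
      \<comment> \<open>Here \<open>d = 0\<close>, so the cubic is divisible by \<open>x\<close>,
        while the bound has become x^4.\<close>
      have "x\<^sup>2 * (a * x\<^sup>2 + b * x + c)\<^sup>2 = (a * x^3 + b * x^2 + c * x + d)\<^sup>2"
        using d True by (simp add: algebra_simps power3_eq_cube power2_eq_square)
      also have "\<dots> \<le> x\<^sup>2 * x\<^sup>2" using assms[of x] True by (simp add: power2_eq_square)
      finally show ?thesis by (rule mult_left_le_imp_le) (use that in simp)
    qed
    then have "c = 0" by (rule quadratic_square_le_imp_const_zero)
    with True show ?thesis by simp
  qed
qed

lemma linear_form_vanishing: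
  fixes s a b c :: real
  assumes "a + b + c = 0" "a * s + b = 0" "c * s + a = 0"
  shows "a = 0 \<and> b = 0 \<and> c = 0"
proof -
  \<comment> \<open>Substitute \<open>a = - c * s\<close> and \<open>b = c * s\<^sup>2\<close> into
    the first equation.\<close>
  have "c * (s\<^sup>2 - s + 1) = 0"
    using assms by (simp add: algebra_simps power2_eq_square) algebra
  then have "c = 0" using discr_pos[of s] by simp
  with assms show ?thesis by simp
qed

lemma dominated_cubic_zero:
  fixes t :: real and Q :: "real \<Rightarrow> real \<Rightarrow> real \<Rightarrow> real"
  assumes Q: "\<And>x y z. Q x y z = x * (a1 * x\<^sup>2 + a2 * y\<^sup>2 + a3 * z\<^sup>2)
      + y * (b1 * x\<^sup>2 + b2 * y\<^sup>2 + b3 * z\<^sup>2) + z * (c1 * x\<^sup>2 + c2 * y\<^sup>2 + c3 * z\<^sup>2) + d * x * y * z"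
    and le: "\<And>x y z. (Q x y z)\<^sup>2 \<le> cyc_cubic (t\<^sup>2) (x\<^sup>2) (y\<^sup>2) (z\<^sup>2)"
  shows "Q x y z = 0"
proof -
  \<comment> \<open>The sextic is even in each variable, so it vanishes at all four sign patterns.
    This gives four independent linear equations for the three coefficient sums and
    \<open>d\<close>.\<close>
  have "Q 1 1 1 = 0" "Q (-1) 1 1 = 0" "Q 1 (-1) 1 = 0" "Q 1 1 (-1) = 0"
    using le[of 1 1 1] le[of "-1" 1 1] le[of 1 "-1" 1] le[of 1 1 "-1"] cyc_cubic_zeros(1) by simp_all
  then have sums: "a1 + a2 + a3 = 0" "b2 + b3 + b1 = 0" "c3 + c1 + c2 = 0" and d: "d = 0"
    unfolding Q by (simp_all add: algebra_simps)
  have bd: "cyc_cubic (t\<^sup>2) (x\<^sup>2) 1 0 = (x\<^sup>2 - t\<^sup>2)\<^sup>2 * (t^4 * x\<^sup>2 + 1)" for x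
    by (simp add: cyc_cubic_boundary)
  have *: "cyc_cubic (t\<^sup>2) 0 (x\<^sup>2) 1 = cyc_cubic (t\<^sup>2) (x\<^sup>2) 1 0"
    "cyc_cubic (t\<^sup>2) 1 0 (x\<^sup>2) = cyc_cubic (t\<^sup>2) (x\<^sup>2) 1 0" for x
    by (metis cyc_cubic_rotate)+
  \<comment> \<open>On the edge z = 0, y = 1 the part odd in \<open>x\<close> comes from the
    \<open>a\<close> coefficients and the even part from the \<open>b\<close> coefficients. Each
    edge thus gives one equation for each of two linear forms, and the three edges together give
    every form the two it needs.\<close>
  have "Q x 1 0 = a1 * x^3 + b1 * x^2 + a2 * x + b2" for x
    by (simp add: Q algebra_simps power3_eq_cube power2_eq_square)
  then have "(a1 * x^3 + b1 * x^2 + a2 * x + b2)\<^sup>2 \<le> (x\<^sup>2 - t\<^sup>2)\<^sup>2 * (t^4 * x\<^sup>2 + 1)" for x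
    using le[of x 1 0] by (simp add: bd)
  note 1 = dominated_boundary_cubic[OF this]
  have "Q 0 x 1 = b2 * x^3 + c2 * x^2 + b3 * x + c3" for x
    by (simp add: Q algebra_simps power3_eq_cube power2_eq_square)
  then have "(b2 * x^3 + c2 * x^2 + b3 * x + c3)\<^sup>2 \<le> (x\<^sup>2 - t\<^sup>2)\<^sup>2 * (t^4 * x\<^sup>2 + 1)" for x
    using le[of 0 x 1] * by (simp add: bd)
  note 2 = dominated_boundary_cubic[OF this]
  have "Q 1 0 x = c3 * x^3 + a3 * x^2 + c1 * x + a1" for x
    by (simp add: Q algebra_simps power3_eq_cube power2_eq_square)
  then have "(c3 * x^3 + a3 * x^2 + c1 * x + a1)\<^sup>2 \<le> (x\<^sup>2 - t\<^sup>2)\<^sup>2 * (t^4 * x\<^sup>2 + 1)" for x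
    using le[of 1 0 x] * by (simp add: bd)
  note 3 = dominated_boundary_cubic[OF this]
  show ?thesis
    using linear_form_vanishing[OF sums(1) 1(1) 3(2)] linear_form_vanishing[OF sums(2) 2(1) 1(2)]
      linear_form_vanishing[OF sums(3) 3(1) 2(2)] d
    by (simp add: Q)
qed

section \<open>The forms \<open>S\<^sub>t\<close>\<close>

lemma eval_form_St:
  "eval_at (form_St t) v = cyc_cubic (t\<^sup>2) ((v $ 1)\<^sup>2) ((v $ 2)\<^sup>2) ((v $ 3)\<^sup>2)"
  unfolding form_St_def cyc_cubic_def
  by (simp add: eval_at_add eval_at_minus eval_at_mult eval_at_power eval_at_Const eval_at_Var
      flip: power_mult)

lemma is_form_St: "is_form 6 (form_St t)"
proof -
  have V: "is_form n (Var i ^ n)" for n :: nat and i :: 3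
    using is_form_power[OF is_form_Var, of n i] by simp
  have C: "is_form n (Const c * p)" if "is_form n p" for n c and p :: "3 rpoly"
    using is_form_mult[OF is_form_Const that] by simp
  have VV: "is_form 6 (Var i ^ 4 * Var j ^ 2)" "is_form 6 (Var i ^ 2 * Var j ^ 4)" for i j :: 3
    using is_form_mult[OF V[of 4 i] V[of 2 j]] is_form_mult[OF V[of 2 i] V[of 4 j]] by simp_all
  have VVV: "is_form 6 (Const c * Var 1 ^ 2 * Var 2 ^ 2 * Var 3 ^ 2 :: 3 rpoly)" for c
    using is_form_mult[OF is_form_mult[OF C[OF V[of 2 1]] V[of 2 2]] V[of 2 3], of c] by simp
  show ?thesis
    unfolding form_St_def by (intro is_form_minus is_form_add C V VV VVV)
qed

lemma psd_form_St: "psd (form_St t)"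
  by (simp add: psd_def eval_form_St cyc_cubic_nonneg)

lemma not_sos_form_St: "\<not> sos (form_St t)"
proof
  assume "sos (form_St t)"
  then obtain k :: nat and q where form: "\<And>j. j < k \<Longrightarrow> \<exists>d. is_form d (q j)"
    and eq: "form_St t = (\<Sum>j<k. (q j)\<^sup>2)"
    unfolding sos_def by blast
  have ev: "eval_at (form_St t) v = (\<Sum>j<k. (eval_at (q j) v)\<^sup>2)" for v
    by (simp add: eq eval_at_sum eval_at_power)
  have "eval_at (q j) w = 0" if j: "j < k" for j w
  proof (rule ccontr)
    \<comment> \<open>The zero polynomial is a form of every degree, so only a summand with a
      nonzero value has its degree forced to be 3.\<close>
    assume nz: "eval_at (q j) w \<noteq> 0"
    obtain d where d: "is_form d (q j)" using form j by blast
    have le: "(eval_at (q j) v)\<^sup>2 \<le> eval_at (form_St t) v" for v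
      unfolding ev using j by (intro member_le_sum) auto
    have "d = 3" using square_le_form_imp_degree[of d "q j" 3, OF d _ le nz] is_form_St by simp
    with d obtain c where c: "\<And>v. eval_at (q j) v
        = (\<Sum>a\<le>3. \<Sum>b\<le>3 - a. c a b * v $ 1 ^ a * v $ 2 ^ b * v $ 3 ^ (3 - a - b))"
      using eval_at_ternary_form[of 3 "q j"] by blast
    define Q where "Q = (\<lambda>x y z. eval_at (q j) (vector [x, y, z]))"
    \<comment> \<open>The ten cubic monomials are grouped by the parities of their exponents;
      \<open>c a b\<close> belongs to x^a y^b z^(3-a-b).\<close>
    have "Q x y z = x * (c 3 0 * x\<^sup>2 + c 1 2 * y\<^sup>2 + c 1 0 * z\<^sup>2)
      + y * (c 2 1 * x\<^sup>2 + c 0 3 * y\<^sup>2 + c 0 1 * z\<^sup>2)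
      + z * (c 2 0 * x\<^sup>2 + c 0 2 * y\<^sup>2 + c 0 0 * z\<^sup>2) + c 1 1 * x * y * z" for x y z
      unfolding Q_def c
      by (simp add: eval_nat_numeral atMost_Suc algebra_simps)
    moreover have "(Q x y z)\<^sup>2 \<le> cyc_cubic (t\<^sup>2) (x\<^sup>2) (y\<^sup>2) (z\<^sup>2)" for x y z
      using le[of "vector [x, y, z]"] by (simp add: Q_def eval_form_St)
    ultimately have "Q (w $ 1) (w $ 2) (w $ 3) = 0" by (rule dominated_cubic_zero)
    moreover have "vector [w $ 1, w $ 2, w $ 3] = w"
      by (simp add: vec_eq_iff forall_3)
    ultimately show False using nz by (simp add: Q_def)
  qed
  then have zero: "eval_at (form_St t) v = 0" for v by (simp add: ev)
  \<comment> \<open>The value at (1,0,0) is t^4, and for \<open>t = 0\<close> the value at (1,1,0)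
    is 1, so the form is not identically zero.\<close>
  have "t = 0" using zero[of "vector [1, 0, 0]"] by (simp add: eval_form_St cyc_cubic_def)
  then show False using zero[of "vector [1, 1, 0]"] by (simp add: eval_form_St cyc_cubic_def)
qed

section \<open>Counting the projective zeros\<close>

definition St_zeros :: "real \<Rightarrow> (real ^ 3) set" where
  "St_zeros t = {vector [1, 1, 1], vector [-1, 1, 1], vector [1, -1, 1], vector [1, 1, -1],
     vector [t, 1, 0], vector [- t, 1, 0], vector [0, t, 1], vector [0, - t, 1],
     vector [1, 0, t], vector [1, 0, - t]}"

lemma vector_3_eq_iff: "vector [a, b, c] = (v :: real ^ 3) \<longleftrightarrow> a = v $ 1 \<and> b = v $ 2 \<and> c = v $ 3"
  by (auto simp: vec_eq_iff forall_3)

lemma card_St_zeros: "t > 0 \<Longrightarrow> card (St_zeros t) = 10"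
  by (simp add: St_zeros_def vector_3_eq_iff)

text \<open>Signs are listed only up to a common factor -1, so no two listed vectors are
  proportional: comparing coordinates pair by pair leaves only equal vectors, and
  \<open>t > 0\<close> keeps \<open>t\<close> and \<open>- t\<close> apart.\<close>

lemma inj_on_span_St_zeros:
  assumes "t > 0"
  shows "inj_on (\<lambda>v. span {v}) (St_zeros t)"
proof (rule inj_onI)
  fix v w assume v: "v \<in> St_zeros t" and w: "w \<in> St_zeros t" and eq: "span {v} = span {w}"
  have "v \<in> span {w}" using eq span_base[of v "{v}"] by simp
  then obtain k where "v = k *\<^sub>R w" by (auto simp: span_singleton)
  then have k: "v $ 1 = k * w $ 1" "v $ 2 = k * w $ 2" "v $ 3 = k * w $ 3" by simp_all
  show "v = w"
    using v w k assms unfolding St_zeros_def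
    by (elim insertE emptyE) (simp_all add: vector_3_eq_iff)
qed

lemma span_singleton_scale:
  fixes v :: "'a::real_vector"
  shows "k \<noteq> 0 \<Longrightarrow> span {k *\<^sub>R v} = span {v}"
  using span_image_scale[of "{v}" "\<lambda>_. k"] by simp

lemma form_St_zero_scaled:
  assumes t: "t > 0" and v: "v \<noteq> 0" and zero: "eval_at (form_St t) v = 0"
  shows "\<exists>k w. k \<noteq> 0 \<and> w \<in> St_zeros t \<and> v = k *\<^sub>R w"
proof -
  have hit: ?thesis if "v = k *\<^sub>R w" "w \<in> St_zeros t" for k w
    using that v by auto
  have v3: "v = k *\<^sub>R vector [a, b, c] \<longleftrightarrow> v $ 1 = k * a \<and> v $ 2 = k * b \<and> v $ 3 = k * c" for k a b c
    by (auto simp: vec_eq_iff forall_3)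
  have sq: "x = t * y \<or> x = - (t * y)" if "x\<^sup>2 = t\<^sup>2 * y\<^sup>2" for x y
    using that by (simp add: power2_eq_iff flip: power_mult_distrib)
  have "cyc_cubic (t\<^sup>2) ((v $ 1)\<^sup>2) ((v $ 2)\<^sup>2) ((v $ 3)\<^sup>2) = 0"
    using zero by (simp add: eval_form_St)
  then consider "(v $ 1)\<^sup>2 = (v $ 2)\<^sup>2" "(v $ 2)\<^sup>2 = (v $ 3)\<^sup>2"
    | "(v $ 1)\<^sup>2 = t\<^sup>2 * (v $ 2)\<^sup>2" "v $ 3 = 0"
    | "(v $ 2)\<^sup>2 = t\<^sup>2 * (v $ 3)\<^sup>2" "v $ 1 = 0"
    | "(v $ 3)\<^sup>2 = t\<^sup>2 * (v $ 1)\<^sup>2" "v $ 2 = 0"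
    using cyc_cubic_zero_cases[of "t\<^sup>2" "(v $ 1)\<^sup>2" "(v $ 2)\<^sup>2" "(v $ 3)\<^sup>2"] t by auto
  then show ?thesis
  proof cases
    case 1
    \<comment> \<open>The scalar is read off at a coordinate where the representative has entry 1;
      for (1,1,-1) the last entry serves with its sign reversed.\<close>
    then have "v = v $ 3 *\<^sub>R vector [1, 1, 1] \<or> v = v $ 3 *\<^sub>R vector [-1, 1, 1]
        \<or> v = v $ 3 *\<^sub>R vector [1, -1, 1] \<or> v = (- v $ 3) *\<^sub>R vector [1, 1, -1]"
      unfolding v3 power2_eq_iff by auto
    then show ?thesis using hit unfolding St_zeros_def by blast
  next
    case 2
    then have "v = v $ 2 *\<^sub>R vector [t, 1, 0] \<or> v = v $ 2 *\<^sub>R vector [- t, 1, 0]"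
      unfolding v3 using sq[of "v $ 1" "v $ 2"] by auto
    then show ?thesis using hit unfolding St_zeros_def by blast
  next
    case 3
    then have "v = v $ 3 *\<^sub>R vector [0, t, 1] \<or> v = v $ 3 *\<^sub>R vector [0, - t, 1]"
      unfolding v3 using sq[of "v $ 2" "v $ 3"] by auto
    then show ?thesis using hit unfolding St_zeros_def by blast
  next
    case 4
    then have "v = v $ 1 *\<^sub>R vector [1, 0, t] \<or> v = v $ 1 *\<^sub>R vector [1, 0, - t]"
      unfolding v3 using sq[of "v $ 3" "v $ 1"] by auto
    then show ?thesis using hit unfolding St_zeros_def by blast
  qed
qed

lemma St_zeros_zero: "w \<in> St_zeros t \<Longrightarrow> w \<noteq> 0 \<and> eval_at (form_St t) w = 0"
  unfolding St_zeros_def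
  by (elim insertE emptyE)
    (simp_all add: vector_3_eq_iff eval_form_St cyc_cubic_zeros)

lemma proj_zeros_form_St:
  assumes "t > 0"
  shows "proj_zeros (form_St t) = (\<lambda>v. span {v}) ` St_zeros t"
proof
  show "proj_zeros (form_St t) \<subseteq> (\<lambda>v. span {v}) ` St_zeros t"
    using form_St_zero_scaled[OF assms] by (fastforce simp: proj_zeros_def span_singleton_scale)
  show "(\<lambda>v. span {v}) ` St_zeros t \<subseteq> proj_zeros (form_St t)"
    using St_zeros_zero[of _ t] by (fastforce simp: proj_zeros_def)
qed

section \<open>The special parameters 0 and 1\<close>

lemma Const_simps: "Const 0 = 0" "Const 1 = 1" "Const (numeral n) = numeral n"
  "Const (- c) = - Const c"
  by (simp_all add: Const_def single_uminus)

lemma form_St_0: "form_St 0 = form_S"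
  by (simp add: form_St_def form_S_def Const_simps)

lemma form_St_1: "form_St 1 = form_R"
  by (simp add: form_St_def form_R_def Const_simps)

theorem mainTheorem11:
  fixes t :: real
  assumes "t \<ge> 0"
  shows "form_St t \<in> Delta_3_6
    \<and> (t > 0 \<longrightarrow> card (proj_zeros (form_St t)) = 10)
    \<and> form_St 0 = form_S
    \<and> form_St 1 = form_R"
  by (simp add: Delta_3_6_def is_form_St psd_form_St not_sos_form_St form_St_0 form_St_1
      proj_zeros_form_St card_image[OF inj_on_span_St_zeros] card_St_zeros)

end
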